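(* Let $N\ge1$ and $\alpha,\beta,\gamma\in[0,1]$ with $\alpha+\beta>0$ and $\alpha+\gamma>0$, and let $k^\star\in\{1,\dots,N\}$ be the integer $k$ with $H_{k-1,N}\ge\frac{\alpha+\gamma}{\alpha+\beta}>H_{k,N}$. Then the strategy $$\tau^\star=\inf\{k:\ k^\star\le k\le N,\ Y_k=1\}\qquad(\inf\emptyset=\partial),$$ that is, reject the first $k^\star-1$ applicants and then accept the first candidate thereafter, is optimal: it maximizes $$\alpha\,\mathbf P(Z_\tau=1,\ \tau\le N)-\beta\,\mathbf P(Z_\tau\ne1,\ \tau\le N)-\gamma\,\mathbf P(\tau=\partial)$$ over all admissible strategies $\tau$.
   Context: $N$ applicants appear in an order given by a uniformly random permutation $(\ell_1,\dots,\ell_N)$ of $\{1,\dots,N\}$. $Z_k=\#\{1\le j\le N:\ell_j\le\ell_k\}$ is the absolute rank and $Y_k=\#\{1\le j\le k:\ell_j\le\ell_k\}$ the relative rank of the $k$-th applicant. The $k$-th applicant is a candidate if $Y_k=1$. Let $\mathcal F_k=\sigma(Y_1,\dots,Y_k)$. An admissible strategy is a random variable $\tau$ with values in $\{1,\dots,N\}\cup\{\partial\}$ such that $\{\tau=k\}\in\mathcal F_k$ for $1\le k\le N$ and $Y_\tau=1$ on $\{\tau\le N\}$ (only candidates are accepted); $\tau=\partial$ means that no applicant is chosen, and $\{\tau\le N\}$ means $\{\tau\neq\partial\}$. Notation: $H_{k,N}=\sum_{j=k}^{N-1}\frac1j$ for $1\le k\le N$ (so $H_{N,N}=0$) and $H_{0,N}=+\infty$.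 *)

theory Defs
  imports "HOL-Probability.Probability"
begin

text \<open>
  The random permutation is a random element \<open>l\<close> of an arbitrary probability space \<open>M\<close>, taking
  values in the permutations of \<open>{1..N}\<close> (viewed as functions that are the identity elsewhere).
\<close>

definition uniform_random_permutation ::
    "'w measure \<Rightarrow> nat \<Rightarrow> ('w \<Rightarrow> nat \<Rightarrow> nat) \<Rightarrow> bool" where
  "uniform_random_permutation M N l \<longleftrightarrow>
     l \<in> M \<rightarrow>\<^sub>M count_space {p. p permutes {1..N}} \<and>
     distr M (count_space {p. p permutes {1..N}}) l = uniform_count_measure {p. p permutes {1..N}}"

definition abs_rank :: "nat \<Rightarrow> ('w \<Rightarrow> nat \<Rightarrow> nat) \<Rightarrow> nat \<Rightarrow> 'w \<Rightarrow> nat" where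
  "abs_rank N l k \<omega> = card {j \<in> {1..N}. l \<omega> j \<le> l \<omega> k}"

definition rel_rank :: "('w \<Rightarrow> nat \<Rightarrow> nat) \<Rightarrow> nat \<Rightarrow> 'w \<Rightarrow> nat" where
  "rel_rank l k \<omega> = card {j \<in> {1..k}. l \<omega> j \<le> l \<omega> k}"

definition rank_sigma :: "'w measure \<Rightarrow> ('w \<Rightarrow> nat \<Rightarrow> nat) \<Rightarrow> nat \<Rightarrow> 'w set set" where
  "rank_sigma M l k =
     sigma_sets (space M) {rel_rank l j -` A \<inter> space M | j A. j \<in> {1..k}}"

text \<open>
  A strategy is a map into \<open>nat option\<close>: \<open>Some k\<close> accepts applicant \<open>k\<close>, and \<open>None\<close> is the
  value \<open>\<partial>\<close> (no applicant is chosen).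
\<close>

definition admissible ::
    "'w measure \<Rightarrow> nat \<Rightarrow> ('w \<Rightarrow> nat \<Rightarrow> nat) \<Rightarrow> ('w \<Rightarrow> nat option) \<Rightarrow> bool" where
  "admissible M N l \<tau> \<longleftrightarrow>
     (\<forall>\<omega>\<in>space M. \<forall>k. \<tau> \<omega> = Some k \<longrightarrow> k \<in> {1..N} \<and> rel_rank l k \<omega> = 1) \<and>
     (\<forall>k\<in>{1..N}. {\<omega> \<in> space M. \<tau> \<omega> = Some k} \<in> rank_sigma M l k)"

definition payoff ::
    "'w measure \<Rightarrow> nat \<Rightarrow> ('w \<Rightarrow> nat \<Rightarrow> nat) \<Rightarrow> real \<Rightarrow> real \<Rightarrow> real \<Rightarrow> ('w \<Rightarrow> nat option) \<Rightarrow> real" where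
  "payoff M N l \<alpha> \<beta> \<gamma> \<tau> =
     \<alpha> * measure M {\<omega> \<in> space M. \<exists>k. \<tau> \<omega> = Some k \<and> abs_rank N l k \<omega> = 1}
   - \<beta> * measure M {\<omega> \<in> space M. \<exists>k. \<tau> \<omega> = Some k \<and> abs_rank N l k \<omega> \<noteq> 1}
   - \<gamma> * measure M {\<omega> \<in> space M. \<tau> \<omega> = None}"

definition harm_tail :: "nat \<Rightarrow> nat \<Rightarrow> ereal" where
  "harm_tail k N = (if k = 0 then \<infinity> else ereal (\<Sum>j = k..<N. 1 / real j))"

definition is_threshold :: "nat \<Rightarrow> real \<Rightarrow> real \<Rightarrow> real \<Rightarrow> nat \<Rightarrow> bool" where
  "is_threshold N \<alpha> \<beta> \<gamma> k \<longleftrightarrow>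
     k \<in> {1..N} \<and>
     harm_tail (k - 1) N \<ge> ereal ((\<alpha> + \<gamma>) / (\<alpha> + \<beta>)) \<and>
     ereal ((\<alpha> + \<gamma>) / (\<alpha> + \<beta>)) > harm_tail k N"

definition threshold_strategy ::
    "nat \<Rightarrow> ('w \<Rightarrow> nat \<Rightarrow> nat) \<Rightarrow> nat \<Rightarrow> 'w \<Rightarrow> nat option" where
  "threshold_strategy N l m \<omega> =
     (let S = {k. m \<le> k \<and> k \<le> N \<and> rel_rank l k \<omega> = 1}
      in if S = {} then None else Some (Inf S))"

end

theory Submission
  imports Defs
begin

text \<open>
  Sending a permutation to its sequence of relative ranks is a bijection onto
  \<open>{1} \<times> {1..2} \<times> \<dots> \<times> {1..N}\<close>, so the event \<open>Y\<^sub>k = 1\<close> has probability \<open>1/k\<close> and is independent of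
  \<open>Y\<^sub>1, \<dots>, Y\<^sub>k\<^sub>-\<^sub>1\<close>. A candidate \<open>k\<close> is the best applicant iff no later candidate
  appears, which by iteration has conditional probability \<open>k/N\<close> given the past. The payoff is
  therefore \<open>-\<gamma> + (\<Sum>k. P(\<tau> = k) g(k))\<close> with \<open>g(k) = (\<alpha>+\<beta>) k/N + \<gamma> - \<beta>\<close>, an optimal
  stopping problem for independent indicators. Its value function \<open>V\<close> is explicit,
  and the Bellman inequality shows that no strategy beats \<open>V(0) - \<gamma>\<close>, with equality for the
  threshold strategy.
\<close>

section \<open>Relative ranks of a permutation\<close>

text \<open>Induction on \<open>n\<close>: the last rank fixes how many earlier positions lie below
  the last one. These positions form initial segments of the order that \<open>p\<close> and
  \<open>q\<close> share on \<open>{1..n}\<close>, so equal size makes them equal.\<close>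

lemma order_determined_by_rel_ranks:
  fixes p q :: "nat \<Rightarrow> nat"
  assumes "inj_on p {1..n}" "inj_on q {1..n}"
    and "\<And>k. k \<in> {1..n} \<Longrightarrow> card {j \<in> {1..k}. p j \<le> p k} = card {j \<in> {1..k}. q j \<le> q k}"
    and "i \<in> {1..n}" "j \<in> {1..n}"
  shows "p i \<le> p j \<longleftrightarrow> q i \<le> q j"
  using assms
proof (induction n arbitrary: i j)
  case 0
  then show ?case by simp
next
  case (Suc n)
  let ?m = "Suc n"
  have IH: "p i \<le> p j \<longleftrightarrow> q i \<le> q j" if "i \<in> {1..n}" "j \<in> {1..n}" for i j
    using Suc.prems(1,2,3) that by (intro Suc.IH) (auto intro: inj_on_subset)
  have neq: "r j \<noteq> r ?m" if "inj_on r {1..?m}" "j \<in> {1..n}" for j and r :: "nat \<Rightarrow> nat"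
    using inj_onD[OF that(1), of j ?m] that(2) by auto
  have below: "card {j \<in> {1..?m}. r j \<le> r ?m} = Suc (card {j \<in> {1..n}. r j < r ?m})"
    if "inj_on r {1..?m}" for r :: "nat \<Rightarrow> nat"
  proof -
    have "{j \<in> {1..?m}. r j \<le> r ?m} = insert ?m {j \<in> {1..n}. r j < r ?m}"
    proof (rule set_eqI)
      fix j
      show "j \<in> {j \<in> {1..?m}. r j \<le> r ?m} \<longleftrightarrow> j \<in> insert ?m {j \<in> {1..n}. r j < r ?m}"
        using neq[OF that, of j] by (cases "j = ?m") (auto simp: le_Suc_eq)
    qed
    then show ?thesis by simp
  qed
  define D where "D = {j \<in> {1..n}. p j < p ?m}"
  define E where "E = {j \<in> {1..n}. q j < q ?m}"
  have card: "card D = card E"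
    using Suc.prems(3)[of ?m] below[OF Suc.prems(1)] below[OF Suc.prems(2)]
    by (simp add: D_def E_def)
  have fin: "finite D" "finite E" by (auto simp: D_def E_def)
  have "D \<subseteq> E \<or> E \<subseteq> D"
  proof (rule ccontr)
    assume "\<not> ?thesis"
    then obtain a b where ab: "a \<in> D" "a \<notin> E" "b \<in> E" "b \<notin> D" by blast
    then have "p a \<le> p b" "\<not> q a \<le> q b" by (auto simp: D_def E_def)
    then show False using IH[of a b] ab by (auto simp: D_def E_def)
  qed
  then have "D = E" using card fin by (metis card_subset_eq)
  then have lt: "p i < p ?m \<longleftrightarrow> q i < q ?m" if "i \<in> {1..n}" for i
    using that by (auto simp: D_def E_def set_eq_iff)
  have le: "r i \<le> r ?m \<longleftrightarrow> r i < r ?m"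
    if "i \<in> {1..n}" "inj_on r {1..?m}" for i and r :: "nat \<Rightarrow> nat"
    using neq[OF that(2,1)] by (simp add: order_le_less)
  show ?case
  proof (cases "i = ?m"; cases "j = ?m")
    assume "i \<noteq> ?m" "j \<noteq> ?m"
    then show ?thesis using Suc.prems(4,5) by (intro IH) auto
  next
    assume "i = ?m" "j \<noteq> ?m"
    then show ?thesis using Suc.prems(5) lt[of j] by (auto simp: not_less[symmetric] le_Suc_eq)
  next
    assume "i \<noteq> ?m" "j = ?m"
    then show ?thesis
      using Suc.prems lt[of i] le[of i p] le[of i q] by auto
  qed simp
qed

text \<open>\<open>p\<close> maps the counted set bijectively onto \<open>{1..p k}\<close>. Hence
  the order pattern alone recovers a permutation.\<close>

lemma permutes_eq_abs_rank:
  fixes p :: "nat \<Rightarrow> nat"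
  assumes "p permutes {1..N}" "k \<in> {1..N}"
  shows "card {j \<in> {1..N}. p j \<le> p k} = p k"
proof -
  have img: "p ` {1..N} = {1..N}" using assms(1) by (rule permutes_image)
  then have "p k \<le> N" using assms(2) by (metis atLeastAtMost_iff imageI)
  have "p ` {j \<in> {1..N}. p j \<le> p k} = {y \<in> p ` {1..N}. y \<le> p k}" by blast
  also have "\<dots> = {1..p k}" unfolding img using \<open>p k \<le> N\<close> by auto
  finally have "p ` {j \<in> {1..N}. p j \<le> p k} = {1..p k}" .
  moreover have "inj_on p {j \<in> {1..N}. p j \<le> p k}"
    using permutes_inj[OF assms(1)] by (rule inj_on_subset) auto
  ultimately show ?thesis by (metis card_atLeastAtMost card_image diff_Suc_1)
qed

text \<open>A variant of the inversion table: for injective \<open>p\<close>, entry \<open>k\<close>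
  is \<open>k\<close> minus the number of earlier larger values. The restriction to
  \<open>{1..N}\<close> places codes in an extensional product.\<close>

definition rank_code :: "nat \<Rightarrow> (nat \<Rightarrow> nat) \<Rightarrow> nat \<Rightarrow> nat" where
  "rank_code N p = (\<lambda>k\<in>{1..N}. card {j \<in> {1..k}. p j \<le> p k})"

text \<open>Relative ranks determine the order and the order determines the values, which gives
  injectivity. Surjectivity follows by counting, since both sides have \<open>fact N\<close>
  elements.\<close>

lemma rank_code_bij:
  "bij_betw (rank_code N) {p. p permutes {1..N}} (\<Pi>\<^sub>E k\<in>{1..N}. {1..k})"
proof -
  have inj: "inj_on (rank_code N) {p. p permutes {1..N}}"
  proof (rule inj_onI, clarify)
    fix p q assume p: "p permutes {1..N}" and q: "q permutes {1..N}"
      and eq: "rank_code N p = rank_code N q"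
    have ord: "p i \<le> p j \<longleftrightarrow> q i \<le> q j" if "i \<in> {1..N}" "j \<in> {1..N}" for i j
    proof (rule order_determined_by_rel_ranks[of p N q])
      show "inj_on p {1..N}" "inj_on q {1..N}"
        using permutes_inj[OF p] permutes_inj[OF q] by (auto intro: inj_on_subset)
      show "card {j \<in> {1..k}. p j \<le> p k} = card {j \<in> {1..k}. q j \<le> q k}"
        if "k \<in> {1..N}" for k
        using fun_cong[OF eq, of k] that by (simp add: rank_code_def)
    qed (use that in auto)
    show "p = q"
    proof
      fix k
      show "p k = q k"
      proof (cases "k \<in> {1..N}")
        case True
        then have "{j \<in> {1..N}. p j \<le> p k} = {j \<in> {1..N}. q j \<le> q k}" using ord by blast
        then show ?thesis using permutes_eq_abs_rank p q True by metis
      next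
        case False
        then show ?thesis using p q by (simp add: permutes_def)
      qed
    qed
  qed
  have "rank_code N p \<in> (\<Pi>\<^sub>E k\<in>{1..N}. {1..k})" for p
  proof (rule PiE_I)
    fix k assume k: "k \<in> {1..N}"
    have "card {j \<in> {1..k}. p j \<le> p k} \<le> card {1..k}" by (rule card_mono) auto
    moreover have "{j \<in> {1..k}. p j \<le> p k} \<noteq> {}" using k by auto
    then have "card {j \<in> {1..k}. p j \<le> p k} > 0" by (simp add: card_gt_0_iff)
    ultimately show "rank_code N p k \<in> {1..k}" using k by (simp add: rank_code_def)
  qed (auto simp: rank_code_def)
  then have sub: "rank_code N ` {p. p permutes {1..N}} \<subseteq> (\<Pi>\<^sub>E k\<in>{1..N}. {1..k})" by blast
  have "card (\<Pi>\<^sub>E k\<in>{1..N}. {1..k}) = (fact N :: nat)"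
    by (simp add: card_PiE fact_prod)
  also have "\<dots> = card {p. p permutes {1..N}}" by (simp add: card_permutations)
  also have "\<dots> = card (rank_code N ` {p. p permutes {1..N}})"
    using inj by (rule card_image[symmetric])
  finally have "rank_code N ` {p. p permutes {1..N}} = (\<Pi>\<^sub>E k\<in>{1..N}. {1..k})"
    using sub by (intro card_subset_eq) (auto intro: finite_PiE)
  then show ?thesis using inj by (simp add: bij_betw_def)
qed

text \<open>\<open>Q\<close> does not see coordinate \<open>k\<close>, so overwriting it turns each
  function with value \<open>c\<close> there into one function per element of \<open>S k\<close>.
  This is independence of a coordinate in counting form.\<close>

lemma card_PiE_fix_coordinate:
  fixes Q :: "(nat \<Rightarrow> nat) \<Rightarrow> bool"
  assumes k: "k \<in> I" and c: "c \<in> S k" and Q: "\<And>f i. Q (f(k := i)) \<longleftrightarrow> Q f"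
  shows "card {f \<in> Pi\<^sub>E I S. Q f} = card {f \<in> Pi\<^sub>E I S. Q f \<and> f k = c} * card (S k)"
proof -
  have "bij_betw (\<lambda>(f, i). f(k := i)) ({f \<in> Pi\<^sub>E I S. Q f \<and> f k = c} \<times> S k) {f \<in> Pi\<^sub>E I S. Q f}"
  proof (rule bij_betw_byWitness[where f' = "\<lambda>f. (f(k := c), f k)"])
    show "(\<lambda>(f, i). f(k := i)) ` ({f \<in> Pi\<^sub>E I S. Q f \<and> f k = c} \<times> S k) \<subseteq> {f \<in> Pi\<^sub>E I S. Q f}"
      using k Q by (auto simp: PiE_iff extensional_def)
    show "(\<lambda>f. (f(k := c), f k)) ` {f \<in> Pi\<^sub>E I S. Q f} \<subseteq> {f \<in> Pi\<^sub>E I S. Q f \<and> f k = c} \<times> S k"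
      using k c Q by (auto simp: PiE_iff extensional_def)
  qed auto
  from bij_betw_same_card[OF this] show ?thesis by (simp add: card_cartesian_product)
qed

text \<open>The product count is carried through the code bijection with
  \<open>S k = {1..k}\<close>; this is the source of the factor \<open>1/k\<close>.\<close>

lemma card_permutes_record:
  fixes Q :: "(nat \<Rightarrow> nat) \<Rightarrow> bool"
  assumes k: "k \<in> {1..N}" and Q: "\<And>f i. Q (f(k := i)) \<longleftrightarrow> Q f"
  shows "card {p. p permutes {1..N} \<and> Q (rank_code N p)} =
    card {p. p permutes {1..N} \<and> Q (rank_code N p) \<and> rank_code N p k = 1} * k"
proof -
  have card: "card {p. p permutes {1..N} \<and> R (rank_code N p)} = card {f \<in> (\<Pi>\<^sub>E k\<in>{1..N}. {1..k}). R f}"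
    for R :: "(nat \<Rightarrow> nat) \<Rightarrow> bool"
  proof (rule bij_betw_same_card[of "rank_code N"])
    show "bij_betw (rank_code N) {p. p permutes {1..N} \<and> R (rank_code N p)}
        {f \<in> (\<Pi>\<^sub>E k\<in>{1..N}. {1..k}). R f}"
      using rank_code_bij[of N] unfolding bij_betw_def by (auto intro: inj_on_subset)
  qed
  show ?thesis
    using card_PiE_fix_coordinate[of k "{1..N}" 1 "\<lambda>k. {1..k}" Q] k Q
      card[of Q] card[of "\<lambda>f. Q f \<and> f k = 1"] by simp
qed

section \<open>Records and the overall best applicant\<close>

lemma card_eq_one_iff_least:
  fixes p :: "nat \<Rightarrow> nat"
  assumes "inj_on p {1..n}" "k \<in> {1..n}"
  shows "card {j \<in> {1..n}. p j \<le> p k} = 1 \<longleftrightarrow> (\<forall>j\<in>{1..n}. p k \<le> p j)"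
proof
  assume "card {j \<in> {1..n}. p j \<le> p k} = 1"
  then obtain x where "{j \<in> {1..n}. p j \<le> p k} = {x}" by (auto simp: card_1_singleton_iff)
  moreover from this have "x = k"
    using assms(2) by (metis (mono_tags, lifting) mem_Collect_eq order_refl singletonD)
  ultimately show "\<forall>j\<in>{1..n}. p k \<le> p j" by (metis (mono_tags, lifting) linear mem_Collect_eq order_refl singletonD)
next
  assume *: "\<forall>j\<in>{1..n}. p k \<le> p j"
  have "j = k" if "j \<in> {1..n}" "p j \<le> p k" for j
    using * assms(2) that by (metis antisym assms(1) inj_onD)
  then have "{j \<in> {1..n}. p j \<le> p k} = {k}" using assms(2) by blast
  then show "card {j \<in> {1..n}. p j \<le> p k} = 1" by simp
qed

text \<open>A later record would tie with the best applicant, against injectivity. Conversely, the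
  position of the overall minimum is itself a record, so without later records it lies at or before
  \<open>k\<close>, where \<open>k\<close> is already minimal.\<close>

lemma best_iff_no_later_record:
  fixes p :: "nat \<Rightarrow> nat"
  assumes inj: "inj_on p {1..N}" and k: "k \<in> {1..N}"
    and rec: "card {j \<in> {1..k}. p j \<le> p k} = 1"
  shows "card {j \<in> {1..N}. p j \<le> p k} = 1 \<longleftrightarrow>
    (\<forall>i\<in>{k<..N}. card {j \<in> {1..i}. p j \<le> p i} \<noteq> 1)"
proof -
  have least: "card {j \<in> {1..i}. p j \<le> p i} = 1 \<longleftrightarrow> (\<forall>j\<in>{1..i}. p i \<le> p j)" if "i \<in> {1..N}" for i
    using that inj by (intro card_eq_one_iff_least) (auto intro: inj_on_subset)
  have recs: "\<forall>j\<in>{1..k}. p k \<le> p j" using rec least[OF k] by simp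
  have "(\<forall>j\<in>{1..N}. p k \<le> p j) \<longleftrightarrow> (\<forall>i\<in>{k<..N}. \<not> (\<forall>j\<in>{1..i}. p i \<le> p j))"
  proof (intro iffI ballI notI)
    fix i assume best: "\<forall>j\<in>{1..N}. p k \<le> p j" and i: "i \<in> {k<..N}"
      and "\<forall>j\<in>{1..i}. p i \<le> p j"
    then have "p i = p k" using k by (intro antisym) auto
    then show False using inj_onD[OF inj, of i k] i k by auto
  next
    fix j assume norec: "\<forall>i\<in>{k<..N}. \<not> (\<forall>j\<in>{1..i}. p i \<le> p j)" and j: "j \<in> {1..N}"
    obtain i where i: "i \<in> {1..N}" "\<forall>j\<in>{1..N}. p i \<le> p j"
      using arg_min_if_finite[of "{1..N}" p] k
      by (metis empty_iff finite_atLeastAtMost not_le)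
    then have "i \<le> k" using norec by (metis atLeastAtMost_iff greaterThanAtMost_iff not_le order_trans)
    then have "p k \<le> p i" using recs i(1) by simp
    then show "p k \<le> p j" using i(2) j by (meson order_trans)
  qed
  then show ?thesis
    using card_eq_one_iff_least[OF inj k] least by auto
qed

section \<open>The filtration of relative ranks\<close>

locale random_ranking = prob_space M for M :: "'w measure" +
  fixes N :: nat and l :: "'w \<Rightarrow> nat \<Rightarrow> nat"
  assumes N: "N \<ge> 1" and uniform: "uniform_random_permutation M N l"
begin

section \<open>Events and probabilities under the uniform ranking\<close>

lemma permutes: "\<omega> \<in> space M \<Longrightarrow> l \<omega> permutes {1..N}"
  using uniform by (auto simp: uniform_random_permutation_def dest: measurable_space)

lemma inj_on_ranking: "\<omega> \<in> space M \<Longrightarrow> inj_on (l \<omega>) S"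
  using permutes permutes_inj by (blast intro: inj_on_subset)

lemma sets_ranking: "{\<omega> \<in> space M. Q (l \<omega>)} \<in> events"
proof -
  have "l -` {p. p permutes {1..N} \<and> Q p} \<inter> space M \<in> events"
    using uniform by (intro measurable_sets[of l M "count_space {p. p permutes {1..N}}"])
      (auto simp: uniform_random_permutation_def)
  also have "l -` {p. p permutes {1..N} \<and> Q p} \<inter> space M = {\<omega> \<in> space M. Q (l \<omega>)}"
    using permutes by auto
  finally show ?thesis .
qed

lemma prob_ranking:
  "prob {\<omega> \<in> space M. Q (l \<omega>)} = card {p. p permutes {1..N} \<and> Q p} / fact N"
proof -
  let ?P = "{p. p permutes {1..N}}"
  have "prob {\<omega> \<in> space M. Q (l \<omega>)} = prob (l -` {p \<in> ?P. Q p} \<inter> space M)"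
    using permutes by (intro arg_cong[where f = prob]) auto
  also have "\<dots> = measure (distr M (count_space ?P) l) {p \<in> ?P. Q p}"
    using uniform by (subst measure_distr) (auto simp: uniform_random_permutation_def)
  also have "\<dots> = measure (uniform_count_measure ?P) {p \<in> ?P. Q p}"
    using uniform by (simp add: uniform_random_permutation_def)
  also have "\<dots> = card {p \<in> ?P. Q p} / card ?P"
    by (rule measure_uniform_count_measure) (auto simp: finite_permutations)
  finally show ?thesis by (simp add: card_permutations)
qed

lemma rank_code_eq: "j \<in> {1..N} \<Longrightarrow> rank_code N (l \<omega>) j = rel_rank l j \<omega>"
  by (simp add: rank_code_def rel_rank_def)

lemma sigma_algebra_rank_sigma: "sigma_algebra (space M) (rank_sigma M l k)"
  unfolding rank_sigma_def by (rule sigma_algebra_sigma_sets) auto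

lemma rank_sigma_mono: "j \<le> k \<Longrightarrow> A \<in> rank_sigma M l j \<Longrightarrow> A \<in> rank_sigma M l k"
  unfolding rank_sigma_def
proof (erule subsetD[OF sigma_sets_mono', rotated], clarify)
  fix i B assume "j \<le> k" "i \<in> {1..j}"
  then show "\<exists>i' B'. rel_rank l i -` B \<inter> space M = rel_rank l i' -` B' \<inter> space M \<and> i' \<in> {1..k}"
    by (intro exI[of _ i] exI[of _ B]) auto
qed

lemma record_in_rank_sigma:
  "j \<in> {1..k} \<Longrightarrow> {\<omega> \<in> space M. rel_rank l j \<omega> = 1} \<in> rank_sigma M l k"
  unfolding rank_sigma_def
  by (intro sigma_sets.Basic CollectI exI[of _ j] exI[of _ "{1}"]) auto

text \<open>Doob-Dynkin representation: the sets of this form include the generators and are closed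
  under complement and countable union.\<close>

lemma rank_sigma_cases:
  assumes "A \<in> rank_sigma M l k"
  obtains Q where "A = {\<omega> \<in> space M. Q (\<lambda>j\<in>{1..k}. rel_rank l j \<omega>)}"
proof -
  have "\<exists>Q. A = {\<omega> \<in> space M. Q (\<lambda>j\<in>{1..k}. rel_rank l j \<omega>)}"
    using assms unfolding rank_sigma_def
  proof (induction rule: sigma_sets.induct)
    case (Basic a)
    then obtain j B where "a = rel_rank l j -` B \<inter> space M" "j \<in> {1..k}" by blast
    then show ?case by (intro exI[of _ "\<lambda>f. f j \<in> B"]) auto
  next
    case Empty
    show ?case by (rule exI[of _ "\<lambda>_. False"]) simp
  next
    case (Compl a)
    then obtain Q where "a = {\<omega> \<in> space M. Q (\<lambda>j\<in>{1..k}. rel_rank l j \<omega>)}" by blast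
    then have "space M - a = {\<omega> \<in> space M. \<not> Q (\<lambda>j\<in>{1..k}. rel_rank l j \<omega>)}" by blast
    then show ?case by (rule exI[of _ "\<lambda>f. \<not> Q f"])
  next
    case (Union a)
    then have "\<forall>i. \<exists>Q. a i = {\<omega> \<in> space M. Q (\<lambda>j\<in>{1..k}. rel_rank l j \<omega>)}" by blast
    from choice[OF this] obtain Q
      where Q: "\<forall>i. a i = {\<omega> \<in> space M. Q i (\<lambda>j\<in>{1..k}. rel_rank l j \<omega>)}" ..
    then have "\<Union> (range a) = {\<omega> \<in> space M. \<exists>i. Q i (\<lambda>j\<in>{1..k}. rel_rank l j \<omega>)}" by blast
    then show ?case by (rule exI[of _ "\<lambda>f. \<exists>i. Q i f"])
  qed
  then show ?thesis using that by blast
qed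

lemma rank_sigma_events: "A \<in> rank_sigma M l k \<Longrightarrow> A \<in> events"
proof (erule rank_sigma_cases)
  fix Q assume "A = {\<omega> \<in> space M. Q (\<lambda>j\<in>{1..k}. rel_rank l j \<omega>)}"
  then show ?thesis
    using sets_ranking[of "\<lambda>p. Q (\<lambda>j\<in>{1..k}. card {i \<in> {1..j}. p i \<le> p j})"]
    by (simp add: rel_rank_def)
qed

section \<open>Independence and probabilities of records\<close>

text \<open>\<open>A\<close> is decided by the code entries before \<open>k\<close>, so entry
  \<open>k\<close> may be overwritten freely and the counting identity applies. This is the
  independence of a record at \<open>k\<close> from the earlier ranks.\<close>

lemma prob_record:
  assumes k: "k \<in> {1..N}" and A: "A \<in> rank_sigma M l (k - 1)"
  shows "prob {\<omega> \<in> A. rel_rank l k \<omega> = 1} = prob A / k"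
proof -
  obtain Q where Q: "A = {\<omega> \<in> space M. Q (\<lambda>j\<in>{1..k-1}. rel_rank l j \<omega>)}"
    using A by (rule rank_sigma_cases)
  define R where "R f = Q (restrict f {1..k-1})" for f :: "nat \<Rightarrow> nat"
  have "(\<lambda>j\<in>{1..k-1}. rel_rank l j \<omega>) = restrict (rank_code N (l \<omega>)) {1..k-1}" for \<omega>
    using k by (intro restrict_ext) (subst rank_code_eq, auto)
  then have A': "A = {\<omega> \<in> space M. R (rank_code N (l \<omega>))}"
    by (simp add: Q R_def)
  have "restrict (f(k := i)) {1..k-1} = restrict f {1..k-1}" for f :: "nat \<Rightarrow> nat" and i
    using k by (intro restrict_ext) auto
  then have R: "R (f(k := i)) \<longleftrightarrow> R f" for f i by (simp only: R_def)
  have rec: "{\<omega> \<in> A. rel_rank l k \<omega> = 1} =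
      {\<omega> \<in> space M. R (rank_code N (l \<omega>)) \<and> rank_code N (l \<omega>) k = 1}"
    using k by (auto simp: A' rank_code_eq)
  have "prob {\<omega> \<in> A. rel_rank l k \<omega> = 1} =
      card {p. p permutes {1..N} \<and> R (rank_code N p) \<and> rank_code N p k = 1} / fact N"
    unfolding rec by (rule prob_ranking)
  moreover have "prob A = card {p. p permutes {1..N} \<and> R (rank_code N p)} / fact N"
    unfolding A' by (rule prob_ranking)
  ultimately have "prob {\<omega> \<in> A. rel_rank l k \<omega> = 1} * k = prob A"
    using card_permutes_record[OF k, of R, OF R] by simp
  then show ?thesis using k by (simp add: field_simps)
qed

lemma no_record_in_rank_sigma:
  assumes "A \<in> rank_sigma M l n" "m \<ge> 1"
  shows "{\<omega> \<in> A. \<forall>j\<in>{m..n}. rel_rank l j \<omega> \<noteq> 1} \<in> rank_sigma M l n"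
proof -
  interpret F: sigma_algebra "space M" "rank_sigma M l n" by (rule sigma_algebra_rank_sigma)
  have "A - (\<Union>j\<in>{m..n}. {\<omega> \<in> space M. rel_rank l j \<omega> = 1}) \<in> rank_sigma M l n"
    using assms by (intro F.Diff F.finite_UN record_in_rank_sigma) auto
  also have "A - (\<Union>j\<in>{m..n}. {\<omega> \<in> space M. rel_rank l j \<omega> = 1}) =
      {\<omega> \<in> A. \<forall>j\<in>{m..n}. rel_rank l j \<omega> \<noteq> 1}"
    using F.sets_into_space[OF assms(1)] by auto
  finally show ?thesis .
qed

text \<open>The factors \<open>1 - 1/j\<close> for \<open>k < j \<le> n\<close> form a telescoping
  product equal to \<open>k/n\<close>.\<close>

lemma prob_no_record:
  assumes k: "k \<ge> 1" and A: "A \<in> rank_sigma M l k" and n: "k \<le> n" "n \<le> N"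
  shows "prob {\<omega> \<in> A. \<forall>j\<in>{k<..n}. rel_rank l j \<omega> \<noteq> 1} = prob A * k / n"
  using n
proof (induction n rule: dec_induct)
  case base
  then show ?case using k by simp
next
  case (step n)
  let ?B = "{\<omega> \<in> A. \<forall>j\<in>{Suc k..n}. rel_rank l j \<omega> \<noteq> 1}"
  have B: "?B \<in> rank_sigma M l n"
    using A step rank_sigma_mono[of k n] by (intro no_record_in_rank_sigma) auto
  have eq: "{\<omega> \<in> A. \<forall>j\<in>{k<..Suc n}. rel_rank l j \<omega> \<noteq> 1} = ?B - {\<omega> \<in> ?B. rel_rank l (Suc n) \<omega> = 1}"
    using step by (auto simp: le_Suc_eq Suc_le_eq)
  have IH: "prob ?B = prob A * k / n"
    using step by (simp add: atLeastSucAtMost_greaterThanAtMost)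
  have "?B \<inter> {\<omega> \<in> space M. rel_rank l (Suc n) \<omega> = 1} \<in> events"
    using B by (intro sets.Int) (auto intro!: rank_sigma_events record_in_rank_sigma[of _ "Suc n"] simp del: One_nat_def)
  also have "?B \<inter> {\<omega> \<in> space M. rel_rank l (Suc n) \<omega> = 1} = {\<omega> \<in> ?B. rel_rank l (Suc n) \<omega> = 1}"
    using sets.sets_into_space[OF rank_sigma_events[OF B]] by auto
  finally have "prob (?B - {\<omega> \<in> ?B. rel_rank l (Suc n) \<omega> = 1}) =
      prob ?B - prob {\<omega> \<in> ?B. rel_rank l (Suc n) \<omega> = 1}"
    by (intro finite_measure_Diff rank_sigma_events[OF B]) auto
  also have "\<dots> = prob ?B - prob ?B / (Suc n)"
    using prob_record[of "Suc n" ?B] B step by simp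
  also have "\<dots> = prob ?B * (n / Suc n)" by (simp add: field_simps)
  also have "\<dots> = prob A * k / Suc n"
    unfolding IH using k step by simp
  finally show ?case unfolding eq .
qed

text \<open>On \<open>A\<close> applicant \<open>k\<close> is a record, so being best overall means
  that no record follows up to \<open>N\<close>.\<close>

lemma prob_best:
  assumes k: "k \<in> {1..N}" and A: "A \<in> rank_sigma M l k"
    and rec: "\<And>\<omega>. \<omega> \<in> A \<Longrightarrow> rel_rank l k \<omega> = 1"
  shows "prob {\<omega> \<in> A. abs_rank N l k \<omega> = 1} = prob A * k / N"
proof -
  have "abs_rank N l k \<omega> = 1 \<longleftrightarrow> (\<forall>j\<in>{k<..N}. rel_rank l j \<omega> \<noteq> 1)" if "\<omega> \<in> A" for \<omega>
  proof -
    have "\<omega> \<in> space M" using that sets.sets_into_space[OF rank_sigma_events[OF A]] by blast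
    then show ?thesis
      using best_iff_no_later_record[OF inj_on_ranking k, of \<omega>] rec[OF that]
      by (simp add: abs_rank_def rel_rank_def)
  qed
  then have "{\<omega> \<in> A. abs_rank N l k \<omega> = 1} = {\<omega> \<in> A. \<forall>j\<in>{k<..N}. rel_rank l j \<omega> \<noteq> 1}"
    by blast
  then show ?thesis using prob_no_record[of k A N] k A by simp
qed

section \<open>Payoff of an admissible strategy\<close>

context
  fixes \<tau> :: "'w \<Rightarrow> nat option"
  assumes adm: "admissible M N l \<tau>"
begin

lemma stop_in_rank_sigma: "k \<in> {1..N} \<Longrightarrow> {\<omega> \<in> space M. \<tau> \<omega> = Some k} \<in> rank_sigma M l k"
  using adm by (simp add: admissible_def)

lemma stop_record: "\<omega> \<in> space M \<Longrightarrow> \<tau> \<omega> = Some k \<Longrightarrow> k \<in> {1..N} \<and> rel_rank l k \<omega> = 1"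
  using adm by (simp add: admissible_def)

text \<open>The event splits over the accepted applicant, whom admissibility confines to
  \<open>{1..N}\<close>. It serves for success, failure and mere acceptance.\<close>

lemma prob_stop_sum:
  assumes meas: "\<And>k. {\<omega> \<in> space M. R k (l \<omega>)} \<in> events"
  shows "prob {\<omega> \<in> space M. \<exists>k. \<tau> \<omega> = Some k \<and> R k (l \<omega>)} =
    (\<Sum>k\<in>{1..N}. prob {\<omega> \<in> space M. \<tau> \<omega> = Some k \<and> R k (l \<omega>)})"
proof -
  let ?E = "\<lambda>k. {\<omega> \<in> space M. \<tau> \<omega> = Some k \<and> R k (l \<omega>)}"
  have "?E k \<in> events" if "k \<in> {1..N}" for k
  proof -
    have "{\<omega> \<in> space M. \<tau> \<omega> = Some k} \<inter> {\<omega> \<in> space M. R k (l \<omega>)} \<in> events"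
      using that meas by (intro sets.Int rank_sigma_events[OF stop_in_rank_sigma])
    then show ?thesis by (rule back_subst[of "\<lambda>A. A \<in> events"]) auto
  qed
  then have "prob (\<Union>k\<in>{1..N}. ?E k) = (\<Sum>k\<in>{1..N}. prob (?E k))"
    by (intro finite_measure_finite_Union) (auto simp: disjoint_family_on_def)
  moreover have "(\<Union>k\<in>{1..N}. ?E k) = {\<omega> \<in> space M. \<exists>k. \<tau> \<omega> = Some k \<and> R k (l \<omega>)}"
    using stop_record by auto
  ultimately show ?thesis by simp
qed

text \<open>Acceptance at \<open>k\<close> is a time-\<open>k\<close> event on which
  \<open>k\<close> is a record, so it succeeds with conditional probability \<open>k/N\<close>. The
  payoff thus becomes linear in the stopping probabilities.\<close>

lemma payoff_eq_sum:
  "payoff M N l \<alpha> \<beta> \<gamma> \<tau> =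
    (\<Sum>k\<in>{1..N}. prob {\<omega> \<in> space M. \<tau> \<omega> = Some k} * ((\<alpha> + \<beta>) * (k / N) + \<gamma> - \<beta>)) - \<gamma>"
proof -
  let ?p = "\<lambda>k. prob {\<omega> \<in> space M. \<tau> \<omega> = Some k}"
  let ?q = "\<lambda>k. prob {\<omega> \<in> space M. \<tau> \<omega> = Some k \<and> abs_rank N l k \<omega> = 1}"
  have win: "?q k = ?p k * (k / N)" if "k \<in> {1..N}" for k
  proof -
    have "{\<omega> \<in> space M. \<tau> \<omega> = Some k \<and> abs_rank N l k \<omega> = 1} =
        {\<omega> \<in> {\<omega> \<in> space M. \<tau> \<omega> = Some k}. abs_rank N l k \<omega> = 1}" by auto
    then show ?thesis
      using prob_best[OF that stop_in_rank_sigma[OF that]] stop_record by simp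
  qed
  have sums: "prob {\<omega> \<in> space M. \<exists>k. \<tau> \<omega> = Some k \<and> abs_rank N l k \<omega> = 1} = (\<Sum>k\<in>{1..N}. ?q k)"
    "prob {\<omega> \<in> space M. \<exists>k. \<tau> \<omega> = Some k \<and> abs_rank N l k \<omega> \<noteq> 1} =
      (\<Sum>k\<in>{1..N}. prob {\<omega> \<in> space M. \<tau> \<omega> = Some k \<and> abs_rank N l k \<omega> \<noteq> 1})"
    unfolding abs_rank_def by (intro prob_stop_sum sets_ranking)+
  have stop: "prob {\<omega> \<in> space M. \<exists>k. \<tau> \<omega> = Some k} = (\<Sum>k\<in>{1..N}. ?p k)"
    using prob_stop_sum[of "\<lambda>_ _. True"] by simp
  have lose: "prob {\<omega> \<in> space M. \<tau> \<omega> = Some k \<and> abs_rank N l k \<omega> \<noteq> 1} = ?p k - ?q k"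
    if "k \<in> {1..N}" for k
  proof -
    have S: "{\<omega> \<in> space M. \<tau> \<omega> = Some k} \<in> events"
      using that by (intro rank_sigma_events[OF stop_in_rank_sigma])
    have B: "{\<omega> \<in> space M. abs_rank N l k \<omega> = 1} \<in> events"
      unfolding abs_rank_def by (rule sets_ranking)
    have "prob ({\<omega> \<in> space M. \<tau> \<omega> = Some k} - {\<omega> \<in> space M. abs_rank N l k \<omega> = 1}) =
        ?p k - prob ({\<omega> \<in> space M. \<tau> \<omega> = Some k} \<inter> {\<omega> \<in> space M. abs_rank N l k \<omega> = 1})"
      using S B by (rule finite_measure_Diff')
    moreover have "{\<omega> \<in> space M. \<tau> \<omega> = Some k} - {\<omega> \<in> space M. abs_rank N l k \<omega> = 1} =
        {\<omega> \<in> space M. \<tau> \<omega> = Some k \<and> abs_rank N l k \<omega> \<noteq> 1}"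
      "{\<omega> \<in> space M. \<tau> \<omega> = Some k} \<inter> {\<omega> \<in> space M. abs_rank N l k \<omega> = 1} =
        {\<omega> \<in> space M. \<tau> \<omega> = Some k \<and> abs_rank N l k \<omega> = 1}"
      by auto
    ultimately show ?thesis by simp
  qed
  have none: "prob {\<omega> \<in> space M. \<tau> \<omega> = None} = 1 - (\<Sum>k\<in>{1..N}. ?p k)"
  proof -
    have "(\<Union>k\<in>{1..N}. {\<omega> \<in> space M. \<tau> \<omega> = Some k}) \<in> events"
      by (intro sets.finite_UN rank_sigma_events[OF stop_in_rank_sigma]) auto
    also have "(\<Union>k\<in>{1..N}. {\<omega> \<in> space M. \<tau> \<omega> = Some k}) = {\<omega> \<in> space M. \<exists>k. \<tau> \<omega> = Some k}"
      using stop_record by auto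
    finally have "prob (space M - {\<omega> \<in> space M. \<exists>k. \<tau> \<omega> = Some k}) = 1 - (\<Sum>k\<in>{1..N}. ?p k)"
      by (simp add: prob_compl stop)
    moreover have "space M - {\<omega> \<in> space M. \<exists>k. \<tau> \<omega> = Some k} = {\<omega> \<in> space M. \<tau> \<omega> = None}"
      by auto
    ultimately show ?thesis by simp
  qed
  have "payoff M N l \<alpha> \<beta> \<gamma> \<tau> = \<alpha> * (\<Sum>k\<in>{1..N}. ?p k * (k / N)) -
      \<beta> * (\<Sum>k\<in>{1..N}. ?p k - ?p k * (k / N)) - \<gamma> * (1 - (\<Sum>k\<in>{1..N}. ?p k))"
    unfolding payoff_def none sums using lose win by simp
  \<comment> \<open>The penalty \<gamma> is charged in advance and refunded on acceptance, which
    puts \<open>+ \<gamma>\<close> into each weight.\<close>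
  also have "\<dots> = (\<Sum>k\<in>{1..N}. \<alpha> * (?p k * (k / N)) - \<beta> * (?p k - ?p k * (k / N)) + \<gamma> * ?p k) - \<gamma>"
    by (simp add: sum.distrib sum_subtractf sum_distrib_left algebra_simps)
  also have "\<dots> = (\<Sum>k\<in>{1..N}. ?p k * ((\<alpha> + \<beta>) * (k / N) + \<gamma> - \<beta>)) - \<gamma>"
    by (intro arg_cong2[where f = minus] sum.cong) (auto simp: algebra_simps add_divide_distrib)
  finally show ?thesis .
qed

section \<open>Continuation events and the Bellman comparison\<close>

text \<open>In usual notation the event \<open>\<tau> > k\<close>, where choosing nobody counts as
  later than \<open>N\<close>.\<close>

definition waiting :: "nat \<Rightarrow> 'w set" where
  "waiting k = {\<omega> \<in> space M. \<forall>j\<in>{1..k}. \<tau> \<omega> \<noteq> Some j}"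

lemma waiting_in_rank_sigma: "k \<le> N \<Longrightarrow> waiting k \<in> rank_sigma M l k"
proof -
  assume k: "k \<le> N"
  interpret F: sigma_algebra "space M" "rank_sigma M l k" by (rule sigma_algebra_rank_sigma)
  have "space M - (\<Union>j\<in>{1..k}. {\<omega> \<in> space M. \<tau> \<omega> = Some j}) \<in> rank_sigma M l k"
    using k by (intro F.compl_sets F.finite_UN) (auto intro!: rank_sigma_mono[OF _ stop_in_rank_sigma])
  then show ?thesis by (rule back_subst[of "\<lambda>A. A \<in> rank_sigma M l k"]) (auto simp: waiting_def)
qed

lemma prob_waiting_Suc:
  assumes "k < N"
  shows "prob (waiting (Suc k)) = prob (waiting k) - prob {\<omega> \<in> space M. \<tau> \<omega> = Some (Suc k)}"
proof -
  have "prob (waiting k - {\<omega> \<in> space M. \<tau> \<omega> = Some (Suc k)}) =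
      prob (waiting k) - prob {\<omega> \<in> space M. \<tau> \<omega> = Some (Suc k)}"
    using assms
    by (intro finite_measure_Diff rank_sigma_events[OF waiting_in_rank_sigma]
        rank_sigma_events[OF stop_in_rank_sigma]) (auto simp: waiting_def)
  also have "waiting k - {\<omega> \<in> space M. \<tau> \<omega> = Some (Suc k)} = waiting (Suc k)"
    by (auto simp: waiting_def atLeastAtMostSuc_conv)
  finally show ?thesis .
qed

text \<open>Accepting at \<open>Suc k\<close> requires a record there while still waiting, and that
  record is independent of \<open>waiting k\<close>.\<close>

lemma prob_stop_le:
  assumes "k < N"
  shows "prob {\<omega> \<in> space M. \<tau> \<omega> = Some (Suc k)} \<le> prob (waiting k) / Suc k"
proof -
  have "{\<omega> \<in> waiting k. rel_rank l (Suc k) \<omega> = 1} = waiting k \<inter> {\<omega> \<in> space M. rel_rank l (Suc k) \<omega> = 1}"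
    by (auto simp: waiting_def)
  also have "\<dots> \<in> events"
    using assms by (intro sets.Int rank_sigma_events[OF waiting_in_rank_sigma]
        rank_sigma_events[OF record_in_rank_sigma[of _ "Suc k"]]) auto
  finally have "prob {\<omega> \<in> space M. \<tau> \<omega> = Some (Suc k)} \<le> prob {\<omega> \<in> waiting k. rel_rank l (Suc k) \<omega> = 1}"
    using stop_record by (intro finite_measure_mono) (auto simp: waiting_def)
  also have "\<dots> = prob (waiting k) / Suc k"
    using assms prob_record[of "Suc k"] waiting_in_rank_sigma[of k] by simp
  finally show ?thesis .
qed

text \<open>The hypothesis is the Bellman equation for independent records of probability
  \<open>1/Suc k\<close>. Gain so far plus expected continuation value starts at \<open>V 0\<close>
  and never increases with \<open>n\<close>.\<close>

lemma verification_le: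
  fixes V g :: "nat \<Rightarrow> real"
  assumes V: "\<And>k. k < N \<Longrightarrow> V k = V (Suc k) + max 0 (g (Suc k) - V (Suc k)) / Suc k"
    and n: "n \<le> N"
  shows "(\<Sum>k\<in>{1..n}. prob {\<omega> \<in> space M. \<tau> \<omega> = Some k} * g k) + prob (waiting n) * V n \<le> V 0"
  using n
proof (induction n)
  case 0
  then show ?case by (simp add: waiting_def prob_space)
next
  case (Suc n)
  let ?p = "prob {\<omega> \<in> space M. \<tau> \<omega> = Some (Suc n)}"
  \<comment> \<open>The left side changes by \<open>?p * (g (Suc n) - V (Suc n))\<close> minus
    \<open>prob (waiting n) * (V n - V (Suc n))\<close>, so the first term is bounded by the
    second.\<close>
  have "?p * (g (Suc n) - V (Suc n)) \<le> ?p * max 0 (g (Suc n) - V (Suc n))"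
    by (intro mult_left_mono) auto
  also have "\<dots> \<le> prob (waiting n) / Suc n * max 0 (g (Suc n) - V (Suc n))"
    using Suc.prems by (intro mult_right_mono prob_stop_le) auto
  also have "\<dots> = prob (waiting n) * (V n - V (Suc n))"
    using V[of n] Suc.prems by simp
  finally show ?case
    using Suc by (simp add: prob_waiting_Suc algebra_simps)
qed

text \<open>Equality in the Bellman inequality: the strategy accepts every candidate from time \<open>m\<close> on,
  where accepting is favourable, and none before.\<close>

lemma verification_eq:
  fixes V g :: "nat \<Rightarrow> real"
  assumes V: "\<And>k. k < N \<Longrightarrow> V k = V (Suc k) + max 0 (g (Suc k) - V (Suc k)) / Suc k"
    and early: "\<And>k. k \<in> {1..N} \<Longrightarrow> k < m \<Longrightarrow> {\<omega> \<in> space M. \<tau> \<omega> = Some k} = {} \<and> g k \<le> V k"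
    and late: "\<And>k. k \<in> {1..N} \<Longrightarrow> m \<le> k \<Longrightarrow>
      {\<omega> \<in> space M. \<tau> \<omega> = Some k} = {\<omega> \<in> waiting (k - 1). rel_rank l k \<omega> = 1} \<and> V k \<le> g k"
    and n: "n \<le> N"
  shows "(\<Sum>k\<in>{1..n}. prob {\<omega> \<in> space M. \<tau> \<omega> = Some k} * g k) + prob (waiting n) * V n = V 0"
  using n
proof (induction n)
  case 0
  then show ?case by (simp add: waiting_def prob_space)
next
  case (Suc n)
  let ?p = "prob {\<omega> \<in> space M. \<tau> \<omega> = Some (Suc n)}"
  \<comment> \<open>If \<open>Suc n < m\<close>, both sides vanish. Otherwise the stopping
    probability attains its upper bound and the maximum is the difference itself.\<close>
  have "?p * (g (Suc n) - V (Suc n)) = prob (waiting n) * (V n - V (Suc n))"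
  proof (cases "Suc n < m")
    case True
    then have stop: "{\<omega> \<in> space M. \<tau> \<omega> = Some (Suc n)} = {}" and le: "g (Suc n) \<le> V (Suc n)"
      using early[of "Suc n"] Suc.prems by auto
    have "?p = 0" unfolding stop by simp
    then show ?thesis using V[of n] Suc.prems le by simp
  next
    case False
    then have "{\<omega> \<in> space M. \<tau> \<omega> = Some (Suc n)} = {\<omega> \<in> waiting n. rel_rank l (Suc n) \<omega> = 1}"
      and ge: "V (Suc n) \<le> g (Suc n)"
      using late[of "Suc n"] Suc.prems by auto
    then have "?p = prob (waiting n) / Suc n"
      using Suc.prems prob_record[of "Suc n"] waiting_in_rank_sigma[of n] by simp
    then show ?thesis using V[of n] Suc.prems ge by simp
  qed
  then show ?case
    using Suc by (simp add: prob_waiting_Suc algebra_simps)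
qed

end

section \<open>Threshold strategies\<close>

text \<open>A nonempty set of naturals attains its infimum, so the infimum can be replaced by a
  first-hitting condition.\<close>

lemma threshold_strategy_eq_Some:
  "threshold_strategy N l m \<omega> = Some k \<longleftrightarrow>
    k \<in> {m..N} \<and> rel_rank l k \<omega> = 1 \<and> (\<forall>j\<in>{m..<k}. rel_rank l j \<omega> \<noteq> 1)"
proof -
  define S where "S = {k. m \<le> k \<and> k \<le> N \<and> rel_rank l k \<omega> = 1}"
  have "threshold_strategy N l m \<omega> = Some k \<longleftrightarrow> S \<noteq> {} \<and> Inf S = k"
    by (auto simp: threshold_strategy_def S_def Let_def)
  also have "\<dots> \<longleftrightarrow> k \<in> S \<and> (\<forall>j<k. j \<notin> S)"
  proof (intro iffI conjI allI impI)
    assume *: "S \<noteq> {} \<and> Inf S = k"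
    then show "k \<in> S" using Inf_nat_def1 by blast
    fix j assume "j < k"
    then show "j \<notin> S" using * by (metis cInf_lower bdd_below_bot not_le)
  next
    assume *: "k \<in> S \<and> (\<forall>j<k. j \<notin> S)"
    then show "S \<noteq> {}" by blast
    show "Inf S = k" using * by (intro cInf_eq_minimum) (auto simp: not_less[symmetric])
  qed
  also have "\<dots> \<longleftrightarrow> k \<in> {m..N} \<and> rel_rank l k \<omega> = 1 \<and> (\<forall>j\<in>{m..<k}. rel_rank l j \<omega> \<noteq> 1)"
    by (auto simp: S_def)
  finally show ?thesis .
qed

lemma threshold_strategy_admissible:
  assumes "m \<ge> 1"
  shows "admissible M N l (threshold_strategy N l m)"
  unfolding admissible_def
proof (intro conjI ballI allI impI)
  fix k assume k: "k \<in> {1..N}"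
  interpret F: sigma_algebra "space M" "rank_sigma M l k" by (rule sigma_algebra_rank_sigma)
  show "{\<omega> \<in> space M. threshold_strategy N l m \<omega> = Some k} \<in> rank_sigma M l k"
  proof (cases "m \<le> k")
    case True
    \<comment> \<open>Only the ranks at times \<open>m\<close> to \<open>k\<close> are consulted,
      and \<open>m \<ge> 1\<close> keeps these times in \<open>{1..k}\<close>.\<close>
    have "{\<omega> \<in> space M. rel_rank l k \<omega> = 1} -
        (\<Union>j\<in>{m..<k}. {\<omega> \<in> space M. rel_rank l j \<omega> = 1}) \<in> rank_sigma M l k"
      using k assms by (intro F.Diff F.finite_UN record_in_rank_sigma) auto
    then show ?thesis
      using True k by (elim back_subst[of "\<lambda>A. A \<in> rank_sigma M l k"])
        (auto simp: threshold_strategy_eq_Some)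
  qed (simp add: threshold_strategy_eq_Some)
qed (use assms in \<open>auto simp: threshold_strategy_eq_Some\<close>)

text \<open>This is the form of the stopping event that the equality case demands. Not having
  stopped before \<open>k\<close> means having met no record since \<open>m\<close>, because the
  first such record would have been accepted.\<close>

lemma threshold_strategy_stop:
  assumes "m \<ge> 1" "k \<in> {m..N}"
  shows "{\<omega> \<in> space M. threshold_strategy N l m \<omega> = Some k} =
    {\<omega> \<in> waiting (threshold_strategy N l m) (k - 1). rel_rank l k \<omega> = 1}"
proof -
  have "(\<forall>j\<in>{m..<k}. rel_rank l j \<omega> \<noteq> 1) \<longleftrightarrow>
      (\<forall>j\<in>{1..k-1}. threshold_strategy N l m \<omega> \<noteq> Some j)" for \<omega>
  proof (intro iffI ballI)
    fix j assume "\<forall>j\<in>{m..<k}. rel_rank l j \<omega> \<noteq> 1" "j \<in> {1..k-1}"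
    then show "threshold_strategy N l m \<omega> \<noteq> Some j"
      by (auto simp: threshold_strategy_eq_Some)
  next
    fix j assume *: "\<forall>j\<in>{1..k-1}. threshold_strategy N l m \<omega> \<noteq> Some j" and "j \<in> {m..<k}"
    from this(2) show "rel_rank l j \<omega> \<noteq> 1"
    proof (induction j rule: less_induct)
      case (less j)
      then show ?case
        using * assms by (auto simp: threshold_strategy_eq_Some)
    qed
  qed
  then have "threshold_strategy N l m \<omega> = Some k \<longleftrightarrow>
      rel_rank l k \<omega> = 1 \<and> (\<forall>j\<in>{1..k-1}. threshold_strategy N l m \<omega> \<noteq> Some j)" for \<omega>
    unfolding threshold_strategy_eq_Some[of m \<omega> k] using assms(2) by blast
  then show ?thesis
    unfolding waiting_def[OF threshold_strategy_admissible[OF assms(1)]] by blast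
qed

end

section \<open>The value function\<close>

lemma harmonic_sum_Suc:
  assumes "1 \<le> k" "k < N"
  shows "(\<Sum>j=k..<N. 1 / real j) = 1 / k + (\<Sum>j=Suc k..<N. 1 / real j)"
  using assms by (simp add: sum.atLeast_Suc_lessThan)

lemma harmonic_sum_antimono:
  assumes "1 \<le> i" "i \<le> k"
  shows "(\<Sum>j=k..<N. 1 / real j) \<le> (\<Sum>j=i..<N. 1 / real j)"
  using assms by (intro sum_mono2) auto

text \<open>The tails are nonincreasing, infinite at \<open>0\<close> and zero at \<open>N\<close>,
  while the ratio is positive. The least index whose tail is below the ratio therefore qualifies,
  and monotonicity excludes a second one.\<close>

lemma ex1_threshold:
  assumes N: "N \<ge> 1" and pos: "\<alpha> + \<beta> > 0" "\<alpha> + \<gamma> > 0"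
  shows "\<exists>!k. is_threshold N \<alpha> \<beta> \<gamma> k"
proof -
  define r where "r = (\<alpha> + \<gamma>) / (\<alpha> + \<beta>)"
  have mono: "harm_tail k N \<le> harm_tail i N" if "i \<le> k" for i k
    using that harmonic_sum_antimono[of i k N] by (auto simp: harm_tail_def)
  define k where "k = (LEAST k. harm_tail k N < ereal r)"
  have "r > 0" using pos by (simp add: r_def)
  then have ex: "harm_tail N N < ereal r" using N by (simp add: harm_tail_def)
  then have k: "harm_tail k N < ereal r" unfolding k_def by (rule LeastI)
  have "k \<le> N" unfolding k_def using ex by (rule Least_le)
  moreover have "k \<noteq> 0"
  proof
    assume "k = 0"
    then show False using k by (simp add: harm_tail_def)
  qed
  moreover from this have "\<not> harm_tail (k - 1) N < ereal r"
    unfolding k_def by (intro not_less_Least) simp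
  ultimately have "is_threshold N \<alpha> \<beta> \<gamma> k"
    using k by (simp add: is_threshold_def r_def not_less)
  moreover have "i = j" if "is_threshold N \<alpha> \<beta> \<gamma> i" "is_threshold N \<alpha> \<beta> \<gamma> j" for i j
  proof -
    \<comment> \<open>Otherwise the tail at \<open>j - 1\<close> would be both below the ratio and
      at least the ratio. Applying this in both orders gives \<open>i = j\<close>.\<close>
    have "\<not> i \<le> j - 1" if "is_threshold N \<alpha> \<beta> \<gamma> i" "is_threshold N \<alpha> \<beta> \<gamma> j" for i j
      using that mono[of i "j - 1"] unfolding is_threshold_def
      by (metis leD order.strict_trans2 order_trans)
    from this[OF that] this[OF that(2,1)] show ?thesis by auto
  qed
  ultimately show ?thesis by blast
qed

text \<open>The numbers \<open>W k\<close> below are the expected gains of rejecting the first \<open>k\<close> applicants and then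
  accepting the first candidate. For \<open>k = 0\<close> the formula would need the convention
  \<open>k \<cdot> (1/k) = 1\<close>, so the case of threshold \<open>1\<close> is treated separately.\<close>

lemma value_function_exists:
  fixes \<alpha> \<beta> \<gamma> :: real
  assumes thr: "is_threshold N \<alpha> \<beta> \<gamma> m" and pos: "\<alpha> + \<beta> > 0"
  defines "g \<equiv> \<lambda>k. (\<alpha> + \<beta>) * (real k / N) + \<gamma> - \<beta>"
  obtains V :: "nat \<Rightarrow> real" where
    "V N = 0"
    "\<And>k. k < N \<Longrightarrow> V k = V (Suc k) + max 0 (g (Suc k) - V (Suc k)) / Suc k"
    "\<And>k. k \<in> {1..N} \<Longrightarrow> k < m \<Longrightarrow> g k \<le> V k"
    "\<And>k. k \<in> {1..N} \<Longrightarrow> m \<le> k \<Longrightarrow> V k \<le> g k"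
proof -
  define H where "H k = (\<Sum>j=k..<N. 1 / real j)" for k
  \<comment> \<open>For \<open>1 \<le> k\<close>, the first candidate after \<open>k\<close> is
    \<open>j\<close> with probability \<open>k/(j(j-1))\<close>. Summing \<open>g j\<close> with
    these weights gives the harmonic term, and the constant part telescopes to
    \<open>1 - k/N\<close>.\<close>
  define W where "W k = (\<alpha> + \<beta>) * (real k / N) * H k + (\<gamma> - \<beta>) * (1 - real k / N)" for k
  \<comment> \<open>Nothing is accepted before \<open>m\<close>, so the value is frozen at
    \<open>W (m - 1)\<close>. With \<open>m = 1\<close> the first applicant, always a candidate, is
    taken and yields \<open>g 1\<close>.\<close>
  define V where "V k = (if k = 0 \<and> m = 1 then g 1 else W (max k (m - 1)))" for k
  \<comment> \<open>The lower bound is restricted to \<open>m \<ge> 2\<close>: division by zero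
    yields zero, so \<open>H 0\<close> is finite, whereas \<open>harm_tail 0 N\<close> is
    infinite.\<close>
  have m: "m \<in> {1..N}" and Hm: "H m < (\<alpha> + \<gamma>) / (\<alpha> + \<beta>)"
    and Hm': "m \<ge> 2 \<Longrightarrow> (\<alpha> + \<gamma>) / (\<alpha> + \<beta>) \<le> H (m - 1)"
    using thr by (auto simp: is_threshold_def harm_tail_def H_def split: if_splits)
  then have N: "N > 0" by simp
  \<comment> \<open>For \<open>k > 0\<close> the sign of \<open>g k - W k\<close> depends only on
    how \<open>H k\<close> compares with the ratio, which is why the optimal rule is a
    threshold.\<close>
  have diff: "g k - W k = real k / N * ((\<alpha> + \<gamma>) - (\<alpha> + \<beta>) * H k)" for k
    using N by (simp add: g_def W_def field_simps)
  \<comment> \<open>This is the Bellman recursion without the maximum, since \<open>W\<close> takes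
    the first candidate unconditionally.\<close>
  have rec: "W k = W (Suc k) + (g (Suc k) - W (Suc k)) / Suc k" if "1 \<le> k" "k < N" for k
  proof -
    have H: "H k = 1 / k + H (Suc k)" using harmonic_sum_Suc[OF that] by (simp add: H_def)
    have step: "(g (Suc k) - W (Suc k)) / Suc k = ((\<alpha> + \<gamma>) - (\<alpha> + \<beta>) * H (Suc k)) / N"
      unfolding diff by (simp del: of_nat_Suc)
    show ?thesis unfolding step unfolding W_def H using that N by (simp add: field_simps)
  qed
  have late: "W k \<le> g k" if "m \<le> k" for k
  proof -
    have "H k \<le> H m" using harmonic_sum_antimono[of m k N] m that by (simp add: H_def)
    then have "H k \<le> (\<alpha> + \<gamma>) / (\<alpha> + \<beta>)" using Hm by simp
    then have "(\<alpha> + \<beta>) * H k \<le> \<alpha> + \<gamma>" using pos by (simp add: field_simps)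
    then have "real k / N * ((\<alpha> + \<gamma>) - (\<alpha> + \<beta>) * H k) \<ge> 0" by (intro mult_nonneg_nonneg) auto
    then show ?thesis using diff[of k] by simp
  qed
  have early: "g k \<le> W k" if "1 \<le> k" "k < m" for k
  proof -
    have "H (m - 1) \<le> H k" using harmonic_sum_antimono[of k "m - 1" N] m that by (simp add: H_def)
    then have "(\<alpha> + \<gamma>) / (\<alpha> + \<beta>) \<le> H k" using Hm' that by simp
    then have "\<alpha> + \<gamma> \<le> (\<alpha> + \<beta>) * H k" using pos by (simp add: field_simps)
    then have "real k / N * ((\<alpha> + \<gamma>) - (\<alpha> + \<beta>) * H k) \<le> 0" by (intro mult_nonneg_nonpos) auto
    then show ?thesis using diff[of k] by simp
  qed
  \<comment> \<open>Below the threshold \<open>g - W\<close> is nonpositive, so by the recursion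
    \<open>W\<close> climbs up to \<open>m - 1\<close>. This yields
    \<open>g k \<le> W k \<le> W (m - 1) = V k\<close>.\<close>
  have W_mono: "W k \<le> W (m - 1)" if "1 \<le> k" "k \<le> m - 1" for k
    using that(2,1)
  proof (induction k rule: inc_induct)
    case base
    then show ?case by simp
  next
    case (step n)
    have "W n = W (Suc n) + (g (Suc n) - W (Suc n)) / Suc n"
      using step m by (intro rec) auto
    also have "\<dots> \<le> W (Suc n)" using early[of "Suc n"] step by (simp add: divide_le_0_iff)
    finally show ?case using step by simp
  qed
  have early': "g k \<le> V k" if "1 \<le> k" "k < m" for k
  proof -
    have "k \<le> m - 1" using that by simp
    then show ?thesis using early[OF that] W_mono[of k] that by (simp add: V_def)
  qed
  have late': "V k = W k" if "m \<le> k" for k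
    using that m by (auto simp: V_def max_def)
  show thesis
  proof (rule that[of V])
    show "V N = 0" using late'[of N] m N by (simp add: W_def H_def)
    show "g k \<le> V k" if "k \<in> {1..N}" "k < m" for k using early' that by simp
    show "V k \<le> g k" if "k \<in> {1..N}" "m \<le> k" for k using late late' that by simp
    \<comment> \<open>If \<open>Suc k < m\<close>, the value is frozen and the maximum is zero.
      Otherwise the maximum is the difference and the recursion for \<open>W\<close> applies, except
      at \<open>k = 0\<close>, where the weight is \<open>1\<close> and only \<open>g 1\<close>
      remains.\<close>
    show "V k = V (Suc k) + max 0 (g (Suc k) - V (Suc k)) / Suc k" if k: "k < N" for k
    proof (cases "Suc k < m")
      case True
      then have "max k (m - 1) = max (Suc k) (m - 1)" by linarith
      then have "V k = V (Suc k)" using True by (simp add: V_def)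
      then show ?thesis using early'[of "Suc k"] True by simp
    next
      case False
      then have V: "V (Suc k) = W (Suc k)" "W (Suc k) \<le> g (Suc k)"
        using late'[of "Suc k"] late[of "Suc k"] by auto
      show ?thesis
      proof (cases "k = 0")
        case True
        then have "m = 1" using False m by simp
        then show ?thesis using V True by (simp add: V_def[of 0])
      next
        case k0: False
        have "max k (m - 1) = k" using False by linarith
        then have "V k = W k" using k0 by (simp add: V_def)
        then show ?thesis using V rec[of k] k k0 by simp
      qed
    qed
  qed
qed

section \<open>Optimality of the threshold strategy\<close>

theorem corollary2p2:
  fixes M :: "'w measure" and N :: nat and l :: "'w \<Rightarrow> nat \<Rightarrow> nat" and \<alpha> \<beta> \<gamma> :: real
  assumes "prob_space M"
    and "N \<ge> 1"
    and "uniform_random_permutation M N l"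
    and "\<alpha> \<in> {0..1}" and "\<beta> \<in> {0..1}" and "\<gamma> \<in> {0..1}"
    and "\<alpha> + \<beta> > 0" and "\<alpha> + \<gamma> > 0"
  shows "(\<exists>!k. is_threshold N \<alpha> \<beta> \<gamma> k) \<and>
    (\<forall>kstar. is_threshold N \<alpha> \<beta> \<gamma> kstar \<longrightarrow>
       admissible M N l (threshold_strategy N l kstar) \<and>
       (\<forall>\<tau>. admissible M N l \<tau> \<longrightarrow>
          payoff M N l \<alpha> \<beta> \<gamma> \<tau> \<le> payoff M N l \<alpha> \<beta> \<gamma> (threshold_strategy N l kstar)))"
proof (intro conjI allI impI)
  interpret random_ranking M N l
    using assms by (simp add: random_ranking_def random_ranking_axioms_def)
  show "\<exists>!k. is_threshold N \<alpha> \<beta> \<gamma> k" using assms by (intro ex1_threshold)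
  fix m assume thr: "is_threshold N \<alpha> \<beta> \<gamma> m"
  then have m: "m \<ge> 1" by (simp add: is_threshold_def)
  then show adm: "admissible M N l (threshold_strategy N l m)"
    by (rule threshold_strategy_admissible)
  fix \<tau> assume \<tau>: "admissible M N l \<tau>"
  define g where "g = (\<lambda>k. (\<alpha> + \<beta>) * (real k / N) + \<gamma> - \<beta>)"
  obtain V where V: "V N = 0"
    "\<And>k. k < N \<Longrightarrow> V k = V (Suc k) + max 0 (g (Suc k) - V (Suc k)) / Suc k"
    "\<And>k. k \<in> {1..N} \<Longrightarrow> k < m \<Longrightarrow> g k \<le> V k"
    "\<And>k. k \<in> {1..N} \<Longrightarrow> m \<le> k \<Longrightarrow> V k \<le> g k"
    using value_function_exists[OF thr \<open>\<alpha> + \<beta> > 0\<close>] unfolding g_def by metis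
  \<comment> \<open>\<open>V N = 0\<close> removes the boundary term of the Bellman comparison at
    \<open>N\<close>.\<close>
  have "payoff M N l \<alpha> \<beta> \<gamma> \<tau> \<le> V 0 - \<gamma>"
    using verification_le[OF \<tau> V(2), of N] V(1) by (simp add: payoff_eq_sum[OF \<tau>] g_def)
  \<comment> \<open>The same \<open>V\<close> gives equality here: the threshold strategy skips
    everyone before \<open>m\<close> and afterwards takes any candidate met while waiting.\<close>
  also have "V 0 = (\<Sum>k\<in>{1..N}. prob {\<omega> \<in> space M. threshold_strategy N l m \<omega> = Some k} * g k) +
      prob (waiting (threshold_strategy N l m) N) * V N"
    using m V threshold_strategy_stop[OF m]
    by (intro verification_eq[OF adm, symmetric, where m = m])
      (auto simp: threshold_strategy_eq_Some)
  also have "\<dots> - \<gamma> = payoff M N l \<alpha> \<beta> \<gamma> (threshold_strategy N l m)"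
    using V(1) by (simp add: payoff_eq_sum[OF adm] g_def)
  finally show "payoff M N l \<alpha> \<beta> \<gamma> \<tau> \<le> payoff M N l \<alpha> \<beta> \<gamma> (threshold_strategy N l m)" .
qed

end
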